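(* Let $v:\mathcal X\to\mathbb R$ be such that $J=-v$ is positive definite and $\kappa J(x)\le c_\pi(x)$ for all $x\in\mathcal X$, for a policy $\pi\in\Pi_0$ and a constant $\kappa>0$. For $\eta>0$, call $$v(x)=\mathbb G_\pi^x\Big[\int_0^\eta\gamma^tR_t\,dt+\gamma^\eta v(X_\eta)\Big]\qquad\forall x\in\mathcal X$$ the integral Bellman equation with horizon $\eta$. Then $\pi\in\Pi_{\mathsf a}$ and $v=v_\pi$ if either (a) or (b) below is true. (a) $v$ is $\mathrm C^1$ and radially unbounded, and satisfies the differential Bellman equation $\alpha v(x)=h(x,\pi(x),\nabla v(x))$ for all $x\in\mathcal X$ or, alternatively, the integral Bellman equation for arbitrarily small $\eta>0$ (i.e., for every $\varepsilon>0$ there is $\eta\in(0,\varepsilon)$ for which it holds). (b) $v$ satisfies the integral Bellman equation for a fixed $\eta>0$, $c_\pi$ is radially unbounded, and there exist a function $\zeta:\mathcal X\to\mathbb R$ and a constant $\underline\alpha<\alpha$, possibly depending on $\pi$, such that for each $x\in\mathcal X$, $$\mathbb G_\pi^x[C_t]\le\zeta(x)\exp(\underline\alpha\,t)\qquad\forall t\in[0,t_{\mathsf{max}}(x;\pi)).$$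
   Context: Nonlinear optimal control setting. State space $\mathcal X=\mathbb R^l$, $\mathcal X^{\mathsf T}=\mathbb R^{1\times l}$, time space $\mathbb T=[0,\infty)$; the action space $\mathcal U\subseteq\mathbb R^m$ (a set $O\cup\partial O$ or $O$ with $O$ open in $\mathbb R^m$) contains $0$. The system is $\dot X_t=f(X_t,U_t)$ with $f:\mathcal X\times\mathcal U\to\mathcal X$ locally Lipschitz and $f(0,0)=0$. The cost function $c:\mathcal X\times\mathcal U\to\mathbb R$ is continuous and positive definite: $c(0,0)=0$ and $c(x,u)>0$ for $(x,u)\ne(0,0)$; the reward is $r=-c$, $R_t=r(X_t,U_t)$, $C_t=-R_t$. $\gamma\in(0,1]$ is the discount factor, $\alpha=-\ln\gamma\ge0$. The Hamiltonian is $h(x,u,p)=r(x,u)+p\,f(x,u)$ (gradients are row vectors), and it is assumed there is a locally Lipschitz $u_*:\mathcal X\times\mathcal X^{\mathsf T}\to\mathcal U$ with $u_*(x,p)\in\arg\max_{u\in\mathcal U}h(x,u,p)$ for all $(x,p)$. A policy is a continuous function $\pi:\mathcal X\to\mathcal U$; write $f_\pi(x)=f(x,\pi(x))$, $c_\pi(x)=c(x,\pi(x))$. $\Pi_0$ is the set of locally Lipschitz policies with $\pi(0)=0$. For a locally Lipschitz policy $\pi$ and $x\in\mathcal X$, $[0,t_{\mathsf{max}}(x;\pi))$ with $t_{\mathsf{max}}(x;\pi)\in(0,\infty]$ is the maximal forward existence interval of the unique solution of $\dot X_t=f_\pi(X_t)$, $X_0=x$ (global existence is not assumed); $\mathbb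 G_\pi^x[Y]$ denotes the value of $Y$ along that solution with $U_t=\pi(X_t)$. An integral Bellman equation with horizon $\eta$ at $x$ is understood to presuppose that the solution from $x$ exists on $[0,\eta]$. The cost value function is $J_\pi(x)=\mathbb G_\pi^x[\int_0^\infty\gamma^tC_t\,dt]\in[0,\infty]$ if $t_{\mathsf{max}}(x;\pi)=\infty$ and $J_\pi(x)=\infty$ otherwise; $v_\pi=-J_\pi$. $\Pi_{\mathsf a}=\{\pi\in\Pi_0: J_\pi(x)<\infty\ \forall x\in\mathcal X\}$ (assumed nonempty). Standing assumptions: for every $\pi\in\Pi_{\mathsf a}$, $v_\pi$ is $\mathrm C^1$ with locally Lipschitz gradient; for every $\pi\in\Pi_0$, $c_\pi$ is radially nonvanishing, i.e., $\inf_{\|x\|\ge\rho}|c_\pi(x)|\not\to0$ as $\rho\to\infty$. A function $g:\mathcal X\to\mathbb R$ is positive definite iff $g(0)=0$ and $g(x)>0$ for $x\ne0$; radially unbounded iff $\inf_{\|x\|\ge\rho}|g(x)|\to\infty$ as $\rho\to\infty$. *)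

theory Defs
  imports "HOL-Analysis.Analysis"
begin

section \<open>Function classes\<close>

text \<open>The library notion is for time-dependent maps; here the map does not depend on time.\<close>

definition locally_lipschitz_on :: "'a::metric_space set \<Rightarrow> ('a \<Rightarrow> 'b::metric_space) \<Rightarrow> bool" where
  "locally_lipschitz_on S g \<longleftrightarrow> local_lipschitz (UNIV :: real set) S (\<lambda>_. g)"

definition positive_definite :: "('a::real_normed_vector \<Rightarrow> real) \<Rightarrow> bool" where
  "positive_definite g \<longleftrightarrow> g 0 = 0 \<and> (\<forall>x. x \<noteq> 0 \<longrightarrow> g x > 0)"

definition outer_inf :: "('a::real_normed_vector \<Rightarrow> real) \<Rightarrow> real \<Rightarrow> real" where
  "outer_inf g \<rho> = (INF x\<in>{x. norm x \<ge> \<rho>}. \<bar>g x\<bar>)"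

definition radially_nonvanishing :: "('a::real_normed_vector \<Rightarrow> real) \<Rightarrow> bool" where
  "radially_nonvanishing g \<longleftrightarrow> \<not> (outer_inf g \<longlongrightarrow> 0) at_top"

definition radially_unbounded :: "('a::real_normed_vector \<Rightarrow> real) \<Rightarrow> bool" where
  "radially_unbounded g \<longleftrightarrow> filterlim (outer_inf g) at_top at_top"

text \<open>Gradients and costates, which are row vectors, are represented by elements of the state
  space; the product of a row vector and a column vector becomes the inner product.\<close>

definition grad :: "('a::real_inner \<Rightarrow> real) \<Rightarrow> 'a \<Rightarrow> 'a" where
  "grad v x = (THE D. GDERIV v x :> D)"

definition is_C1 :: "('a::euclidean_space \<Rightarrow> real) \<Rightarrow> bool" where
  "is_C1 v \<longleftrightarrow> (\<forall>x. v differentiable (at x)) \<and> continuous_on UNIV (grad v)"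

section \<open>Autonomous initial value problems\<close>

definition solves_ivp ::
    "('a::real_normed_vector \<Rightarrow> 'a) \<Rightarrow> 'a \<Rightarrow> real \<Rightarrow> (real \<Rightarrow> 'a) \<Rightarrow> bool" where
  "solves_ivp F x T X \<longleftrightarrow>
     X 0 = x \<and> (\<forall>t\<in>{0..T}. (X has_vector_derivative F (X t)) (at t within {0..T}))"

text \<open>For a locally Lipschitz field \<open>F\<close>, \<open>{t. 0 \<le> t \<and> ereal t < exit_time F x}\<close> is the maximal
  forward existence interval, and \<open>traj F x t\<close>, meaningful for \<open>t\<close> in that interval only, is the
  value at \<open>t\<close> of the unique solution starting at \<open>x\<close>.\<close>

definition exit_time :: "('a::real_normed_vector \<Rightarrow> 'a) \<Rightarrow> 'a \<Rightarrow> ereal" where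
  "exit_time F x = Sup {ereal T | T. 0 \<le> T \<and> (\<exists>X. solves_ivp F x T X)}"

definition traj :: "('a::real_normed_vector \<Rightarrow> 'a) \<Rightarrow> 'a \<Rightarrow> real \<Rightarrow> 'a" where
  "traj F x t = (THE y. \<exists>X. solves_ivp F x t X \<and> X t = y)"

section \<open>Policies and values\<close>

text \<open>The dynamics \<open>f\<close> and the cost \<open>c\<close> are functions on states and actions of which only the
  values at actions in the action space \<open>U\<close> are relevant.\<close>

definition closed_loop :: "('x \<Rightarrow> 'u \<Rightarrow> 'b) \<Rightarrow> ('x \<Rightarrow> 'u) \<Rightarrow> 'x \<Rightarrow> 'b" where
  "closed_loop g \<pi> x = g x (\<pi> x)"

definition reward :: "('x \<Rightarrow> 'u \<Rightarrow> real) \<Rightarrow> 'x \<Rightarrow> 'u \<Rightarrow> real" where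
  "reward c x u = - c x u"

definition hamiltonian ::
    "('x \<Rightarrow> 'u \<Rightarrow> 'x::real_inner) \<Rightarrow> ('x \<Rightarrow> 'u \<Rightarrow> real) \<Rightarrow> 'x \<Rightarrow> 'u \<Rightarrow> 'x \<Rightarrow> real" where
  "hamiltonian f c x u p = reward c x u + p \<bullet> f x u"

definition policies :: "(real^'m) set \<Rightarrow> (real^'l \<Rightarrow> real^'m) set" where
  "policies U = {\<pi>. continuous_on UNIV \<pi> \<and> range \<pi> \<subseteq> U}"

definition policies0 :: "(real^'m) set \<Rightarrow> (real^'l \<Rightarrow> real^'m) set" where
  "policies0 U = {\<pi> \<in> policies U. locally_lipschitz_on UNIV \<pi> \<and> \<pi> 0 = 0}"

definition cost_value ::
    "(real^'l \<Rightarrow> real^'m \<Rightarrow> real^'l) \<Rightarrow> (real^'l \<Rightarrow> real^'m \<Rightarrow> real) \<Rightarrow> real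
      \<Rightarrow> (real^'l \<Rightarrow> real^'m) \<Rightarrow> real^'l \<Rightarrow> ennreal" where
  "cost_value f c \<gamma> \<pi> x =
     (if exit_time (closed_loop f \<pi>) x = \<infinity>
      then \<integral>\<^sup>+t\<in>{0..}. ennreal (\<gamma> powr t * closed_loop c \<pi> (traj (closed_loop f \<pi>) x t)) \<partial>lborel
      else \<infinity>)"

definition value_fn ::
    "(real^'l \<Rightarrow> real^'m \<Rightarrow> real^'l) \<Rightarrow> (real^'l \<Rightarrow> real^'m \<Rightarrow> real) \<Rightarrow> real
      \<Rightarrow> (real^'l \<Rightarrow> real^'m) \<Rightarrow> real^'l \<Rightarrow> ereal" where
  "value_fn f c \<gamma> \<pi> x = - enn2ereal (cost_value f c \<gamma> \<pi> x)"

definition admissible_policies ::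
    "(real^'m) set \<Rightarrow> (real^'l \<Rightarrow> real^'m \<Rightarrow> real^'l) \<Rightarrow> (real^'l \<Rightarrow> real^'m \<Rightarrow> real) \<Rightarrow> real
      \<Rightarrow> (real^'l \<Rightarrow> real^'m) set" where
  "admissible_policies U f c \<gamma> = {\<pi> \<in> policies0 U. \<forall>x. cost_value f c \<gamma> \<pi> x < \<infinity>}"

text \<open>Existence of the solution on \<open>{0..\<eta>}\<close> from every initial state is part of the equation.\<close>

definition integral_bellman ::
    "(real^'l \<Rightarrow> real^'m \<Rightarrow> real^'l) \<Rightarrow> (real^'l \<Rightarrow> real^'m \<Rightarrow> real) \<Rightarrow> real
      \<Rightarrow> (real^'l \<Rightarrow> real^'m) \<Rightarrow> (real^'l \<Rightarrow> real) \<Rightarrow> real \<Rightarrow> bool" where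
  "integral_bellman f c \<gamma> \<pi> v \<eta> \<longleftrightarrow>
     (\<forall>x. ereal \<eta> < exit_time (closed_loop f \<pi>) x \<and>
          v x = integral {0..\<eta>}
                  (\<lambda>t. \<gamma> powr t * closed_loop (reward c) \<pi> (traj (closed_loop f \<pi>) x t))
                + \<gamma> powr \<eta> * v (traj (closed_loop f \<pi>) x \<eta>))"

definition differential_bellman ::
    "(real^'l \<Rightarrow> real^'m \<Rightarrow> real^'l) \<Rightarrow> (real^'l \<Rightarrow> real^'m \<Rightarrow> real) \<Rightarrow> real
      \<Rightarrow> (real^'l \<Rightarrow> real^'m) \<Rightarrow> (real^'l \<Rightarrow> real) \<Rightarrow> bool" where
  "differential_bellman f c \<gamma> \<pi> v \<longleftrightarrow>
     (\<forall>x. - ln \<gamma> * v x = hamiltonian f c x (\<pi> x) (grad v x))"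

section \<open>Standing assumptions\<close>

locale optimal_control =
  fixes U :: "(real^'m) set"
    and f :: "real^'l \<Rightarrow> real^'m \<Rightarrow> real^'l"
    and c :: "real^'l \<Rightarrow> real^'m \<Rightarrow> real"
    and \<gamma> :: real
  assumes action_space: "\<exists>S. open S \<and> (U = S \<or> U = S \<union> frontier S)"
    and zero_action: "0 \<in> U"
    and dynamics_lipschitz: "locally_lipschitz_on (UNIV \<times> U) (\<lambda>(x, u). f x u)"
    and dynamics_zero: "f 0 0 = 0"
    and cost_continuous: "continuous_on (UNIV \<times> U) (\<lambda>(x, u). c x u)"
    and cost_zero: "c 0 0 = 0"
    and cost_pos: "\<And>x u. u \<in> U \<Longrightarrow> (x, u) \<noteq> (0, 0) \<Longrightarrow> c x u > 0"
    and discount: "0 < \<gamma>" "\<gamma> \<le> 1"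
    and maximizer: "\<exists>ustar. locally_lipschitz_on UNIV (\<lambda>(x, p). ustar x p) \<and>
          (\<forall>x p. is_arg_max (\<lambda>u. hamiltonian f c x u p) (\<lambda>u. u \<in> U) (ustar x p))"
    and admissible_nonempty: "admissible_policies U f c \<gamma> \<noteq> {}"
    and value_regular: "\<And>\<pi>. \<pi> \<in> admissible_policies U f c \<gamma> \<Longrightarrow>
          is_C1 (\<lambda>x. real_of_ereal (value_fn f c \<gamma> \<pi> x)) \<and>
          locally_lipschitz_on UNIV (grad (\<lambda>x. real_of_ereal (value_fn f c \<gamma> \<pi> x)))"
    and cost_nonvanishing: "\<And>\<pi>. \<pi> \<in> policies0 U \<Longrightarrow> radially_nonvanishing (closed_loop c \<pi>)"

end

theory Submission
  imports Defs
begin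

text \<open>Write \<open>J = - v\<close>, \<open>k\<close> for the cost along the closed loop and \<open>X\<close> for a solution. Either
  Bellman equation says that \<open>\<gamma>\<^sup>t J (X t)\<close> decreases by exactly the discounted cost incurred, so
  \<open>J\<close> is the cost value as soon as solutions are global and \<open>\<gamma>\<^sup>t J (X t)\<close> tends to \<open>0\<close>. The
  differential equation and \<open>\<kappa> J \<le> k\<close> give \<open>\<gamma>\<^sup>t J (X t) \<le> e\<^sup>-\<^sup>\<kappa>\<^sup>t J (X 0)\<close>, which by radial
  unboundedness also excludes blow-up in finite time. An integral equation yields existence on a time
  interval of fixed length from every state, hence globally; in case (b) the growth bound on \<open>k\<close> and
  \<open>J \<le> k / \<kappa>\<close> give the decay along the multiples of \<open>\<eta>\<close>.\<close>

section \<open>Locally Lipschitz functions\<close>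

lemma locally_lipschitz_on_compact:
  assumes "locally_lipschitz_on S g" "compact K" "K \<subseteq> S"
  obtains L where "L-lipschitz_on K g"
proof -
  \<comment> \<open>The passage to a uniform constant needs a compact time set as well, so the dummy
    time set \<open>UNIV\<close> is cut down to one point.\<close>
  have "local_lipschitz {0::real} K (\<lambda>_. g)"
    using assms by (auto simp: locally_lipschitz_on_def intro: local_lipschitz_subset)
  from local_lipschitz_compact_implies_lipschitz[OF this \<open>compact K\<close>] that show ?thesis
    by auto
qed

lemma locally_lipschitz_onI:
  assumes "\<And>x. x \<in> S \<Longrightarrow> \<exists>L. L-lipschitz_on (cball x 1 \<inter> S) g"
  shows "locally_lipschitz_on S g"
  unfolding locally_lipschitz_on_def
  by (rule local_lipschitzI) (use assms zero_less_one in blast)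

text \<open>The graph of \<open>p\<close> over a closed ball is compact and stays inside
  \<open>UNIV \<times> U\<close>, so one constant for \<open>g\<close> serves the whole graph,
  whatever the shape of \<open>U\<close>.\<close>

lemma locally_lipschitz_on_compose_Pair:
  fixes g :: "'a::heine_borel \<Rightarrow> 'b::metric_space \<Rightarrow> 'c::metric_space"
  assumes g: "locally_lipschitz_on (UNIV \<times> U) (\<lambda>(x, u). g x u)"
    and p: "locally_lipschitz_on UNIV p" and "range p \<subseteq> U"
  shows "locally_lipschitz_on UNIV (\<lambda>x. g x (p x))"
proof (rule locally_lipschitz_onI)
  fix x :: 'a
  let ?K = "cball x 1"
  obtain M where "M-lipschitz_on ?K p"
    by (rule locally_lipschitz_on_compact[OF p compact_cball subset_UNIV])
  from lipschitz_on_Pair[OF lipschitz_on_id this]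
  have h: "(sqrt (1\<^sup>2 + M\<^sup>2))-lipschitz_on ?K (\<lambda>x. (x, p x))" .
  have "compact ((\<lambda>x. (x, p x)) ` ?K)"
    by (intro compact_continuous_image lipschitz_on_continuous_on[OF h] compact_cball)
  moreover have "(\<lambda>x. (x, p x)) ` ?K \<subseteq> UNIV \<times> U"
    using \<open>range p \<subseteq> U\<close> by auto
  ultimately obtain N where "N-lipschitz_on ((\<lambda>x. (x, p x)) ` ?K) (\<lambda>(x, u). g x u)"
    by (rule locally_lipschitz_on_compact[OF g])
  from lipschitz_on_compose2[OF h this]
  show "\<exists>L. L-lipschitz_on (?K \<inter> UNIV) (\<lambda>x. g x (p x))"
    by auto
qed

text \<open>Derivatives within the closed interval suffice, which is exactly what
  \<open>solves_ivp\<close> provides at the end points.\<close>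

lemma vector_derivative_nonneg_imp_le:
  fixes g :: "real \<Rightarrow> real"
  assumes "a \<le> b"
    and "\<And>t. t \<in> {a..b} \<Longrightarrow> (g has_vector_derivative g' t) (at t within {a..b})"
    and "\<And>t. t \<in> {a..b} \<Longrightarrow> 0 \<le> g' t"
  shows "g a \<le> g b"
  using has_integral_nonneg[OF fundamental_theorem_of_calculus[OF assms(1,2)] assms(3)] by simp

section \<open>Solutions of autonomous initial value problems\<close>

lemma solves_ivp_continuous_on:
  "solves_ivp F x T X \<Longrightarrow> continuous_on {0..T} X"
  unfolding solves_ivp_def
  by (auto simp: continuous_on_eq_continuous_within intro: has_vector_derivative_continuous)

lemma solves_ivp_restrict:
  assumes "solves_ivp F x T X" "S \<le> T"
  shows "solves_ivp F x S X"
  using assms unfolding solves_ivp_def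
  by (auto intro: has_vector_derivative_within_subset[of _ _ _ "{0..T}"])

lemma solves_ivp_cong:
  assumes "solves_ivp F x T X" "0 \<le> T" "\<And>t. t \<in> {0..T} \<Longrightarrow> Y t = X t"
  shows "solves_ivp F x T Y"
  using assms unfolding solves_ivp_def
  by (auto intro: has_vector_derivative_transform)

lemma solves_ivp_shift:
  assumes "solves_ivp F x (S + T) X" "0 \<le> S"
  shows "solves_ivp F (X S) T (\<lambda>t. X (S + t))"
  unfolding solves_ivp_def
proof (intro conjI ballI)
  fix t assume t: "t \<in> {0..T}"
  have "((X \<circ> (\<lambda>t. S + t)) has_vector_derivative (1 *\<^sub>R F (X (S + t)))) (at t within {0..T})"
  proof (rule vector_diff_chain_within)
    show "((\<lambda>t. S + t) has_vector_derivative 1) (at t within {0..T})"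
      by (auto intro!: derivative_eq_intros)
    have "(X has_vector_derivative F (X (S + t))) (at (S + t) within {0..S + T})"
      using assms t unfolding solves_ivp_def by auto
    then show "(X has_vector_derivative F (X (S + t))) (at (S + t) within (+) S ` {0..T})"
      by (rule has_vector_derivative_within_subset) (use assms(2) in auto)
  qed
  then show "((\<lambda>t. X (S + t)) has_vector_derivative F (X (S + t))) (at t within {0..T})"
    by (simp add: o_def)
qed simp

text \<open>Since the field does not depend on time, the delayed \<open>Y\<close> solves the same
  equation after time \<open>S\<close>. At \<open>S\<close> the two pieces agree in value, hence
  also in derivative, because \<open>Y 0 = X S\<close>.\<close>

lemma solves_ivp_join:
  assumes X: "solves_ivp F x S X" and Y: "solves_ivp F (X S) T Y" and "0 \<le> S" "0 \<le> T"
  shows "solves_ivp F x (S + T) (\<lambda>t. if t \<in> {0..S} then X t else Y (t - S))"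
    (is "solves_ivp F x _ ?Z")
  unfolding solves_ivp_def
proof (intro conjI ballI)
  show "?Z 0 = x"
    using X \<open>0 \<le> S\<close> by (simp add: solves_ivp_def)
next
  have Y0: "Y 0 = X S"
    using Y by (simp add: solves_ivp_def)
  fix t assume t: "t \<in> {0..S + T}"
  \<comment> \<open>The two closures meet only in \<open>S\<close>, which belongs to both intervals
    already.\<close>
  have un: "{0..S} \<union> (closure {0..S} \<inter> closure {S..S+T}) = {0..S}"
    "{S..S+T} \<union> (closure {0..S} \<inter> closure {S..S+T}) = {S..S+T}"
    using \<open>0 \<le> S\<close> \<open>0 \<le> T\<close> by auto
  have "(?Z has_vector_derivative (if t \<in> {0..S} then F (X t) else F (Y (t - S))))
      (at t within {0..S + T})"
  proof (rule has_vector_derivative_If_within_closures[where T = "{S..S+T}"])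
    show "t \<in> {0..S} \<union> {S..S+T}" "{0..S+T} = {0..S} \<union> {S..S+T}"
      using t \<open>0 \<le> S\<close> \<open>0 \<le> T\<close> by auto
    show "(X has_vector_derivative F (X t))
        (at t within {0..S} \<union> (closure {0..S} \<inter> closure {S..S+T}))"
      if "t \<in> {0..S} \<union> (closure {0..S} \<inter> closure {S..S+T})"
      using that X unfolding un by (auto simp: solves_ivp_def)
    show "((\<lambda>t. Y (t - S)) has_vector_derivative F (Y (t - S)))
        (at t within {S..S+T} \<union> (closure {0..S} \<inter> closure {S..S+T}))"
      if "t \<in> {S..S+T} \<union> (closure {0..S} \<inter> closure {S..S+T})"
    proof -
      have t: "t - S \<in> {0..T}" using that unfolding un by auto
      have "((Y \<circ> (\<lambda>t. t - S)) has_vector_derivative (1 *\<^sub>R F (Y (t - S)))) (at t within {S..S+T})"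
      proof (rule vector_diff_chain_within)
        show "((\<lambda>t. t - S) has_vector_derivative 1) (at t within {S..S+T})"
          by (auto intro!: derivative_eq_intros)
        have "(Y has_vector_derivative F (Y (t - S))) (at (t - S) within {0..T})"
          using Y t unfolding solves_ivp_def by auto
        then show "(Y has_vector_derivative F (Y (t - S))) (at (t - S) within (\<lambda>t. t - S) ` {S..S+T})"
          by (rule has_vector_derivative_within_subset) auto
      qed
      then show ?thesis unfolding un by (simp add: o_def)
    qed
    show "X t = Y (t - S)" "F (X t) = F (Y (t - S))"
      if "t \<in> closure {0..S}" "t \<in> closure {S..S+T}"
      using that Y0 by (auto simp: closed_real_atLeastAtMost closure_closed order_antisym)
  qed
  then show "(?Z has_vector_derivative F (?Z t)) (at t within {0..S + T})"
    by (simp add: if_distrib)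
qed

text \<open>A Gronwall argument: with \<open>L\<close> a Lipschitz constant on a compact set
  containing both curves, the squared distance times \<open>exp (- (2 * L) * t)\<close> is
  nonincreasing and starts at 0. Its negative is \<open>w\<close>, and the sign of \<open>w'\<close>
  comes from Cauchy-Schwarz.\<close>

lemma solves_ivp_unique:
  fixes F :: "'a::euclidean_space \<Rightarrow> 'a"
  assumes F: "locally_lipschitz_on UNIV F"
    and X: "solves_ivp F x T X" and Y: "solves_ivp F x T Y" and t: "t \<in> {0..T}"
  shows "X t = Y t"
proof -
  define K where "K = X ` {0..T} \<union> Y ` {0..T}"
  have "compact K"
    unfolding K_def using solves_ivp_continuous_on X Y
    by (intro compact_Un compact_continuous_image) auto
  then obtain L where L: "L-lipschitz_on K F"
    using locally_lipschitz_on_compact[OF F] by blast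
  define w where "w t = - (exp (- (2 * L) * t) * ((X t - Y t) \<bullet> (X t - Y t)))" for t
  define w' where "w' t = 2 * exp (- (2 * L) * t)
      * (L * ((X t - Y t) \<bullet> (X t - Y t)) - (X t - Y t) \<bullet> (F (X t) - F (Y t)))" for t
  have "w 0 \<le> w t"
  proof (rule vector_derivative_nonneg_imp_le[where g = w and g' = w'])
    fix s assume s: "s \<in> {0..t}"
    then have d: "(X has_vector_derivative F (X s)) (at s within {0..t})"
        "(Y has_vector_derivative F (Y s)) (at s within {0..t})"
      using X Y t unfolding solves_ivp_def
      by (auto intro: has_vector_derivative_within_subset[of _ _ _ "{0..T}"])
    show "(w has_vector_derivative w' s) (at s within {0..t})"
      unfolding w_def w'_def has_vector_derivative_def
      by (rule derivative_eq_intros d[unfolded has_vector_derivative_def] refl)+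
        (auto simp: fun_eq_iff inner_commute algebra_simps)
    have "X s \<in> K" "Y s \<in> K"
      using s t by (auto simp: K_def)
    then have "norm (F (X s) - F (Y s)) \<le> L * norm (X s - Y s)"
      using lipschitz_onD[OF L] by (simp add: dist_norm)
    then have "norm (X s - Y s) * norm (F (X s) - F (Y s))
        \<le> norm (X s - Y s) * (L * norm (X s - Y s))"
      by (intro mult_left_mono) auto
    then have "(X s - Y s) \<bullet> (F (X s) - F (Y s)) \<le> L * ((X s - Y s) \<bullet> (X s - Y s))"
      using norm_cauchy_schwarz[of "X s - Y s" "F (X s) - F (Y s)"]
      by (simp add: dot_square_norm power2_eq_square algebra_simps)
    then show "0 \<le> w' s"
      by (simp add: w'_def)
  qed (use t in simp)
  moreover have "w 0 = 0"
    using X Y by (simp add: w_def solves_ivp_def)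
  ultimately have "exp (- (2 * L) * t) * ((X t - Y t) \<bullet> (X t - Y t)) \<le> 0"
    by (simp add: w_def)
  then have "(X t - Y t) \<bullet> (X t - Y t) \<le> 0"
    by (simp add: mult_le_0_iff)
  then have "X t - Y t = 0"
    using inner_ge_zero[of "X t - Y t"] inner_eq_zero_iff[of "X t - Y t"] by linarith
  then show ?thesis by simp
qed

lemma traj_eq:
  fixes F :: "'a::euclidean_space \<Rightarrow> 'a"
  assumes F: "locally_lipschitz_on UNIV F" and X: "solves_ivp F x T X" and t: "t \<in> {0..T}"
  shows "traj F x t = X t"
  unfolding traj_def
proof (rule the_equality)
  have X': "solves_ivp F x t X"
    using solves_ivp_restrict[OF X] t by auto
  then show "\<exists>Y. solves_ivp F x t Y \<and> Y t = X t" by blast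
  show "y = X t" if "\<exists>Y. solves_ivp F x t Y \<and> Y t = y" for y
    using that solves_ivp_unique[OF F X'] t by auto
qed

section \<open>Exit times, trajectories and criteria for global existence\<close>

lemma less_exit_timeE:
  assumes "ereal t < exit_time F x"
  obtains T X where "t < T" "0 \<le> T" "solves_ivp F x T X"
  using assms unfolding exit_time_def less_Sup_iff by auto

lemma exit_time_eq_infinityI:
  assumes "\<And>T. T \<ge> 0 \<Longrightarrow> \<exists>S\<ge>T. \<exists>X. solves_ivp F x S X"
  shows "exit_time F x = \<infinity>"
proof (rule ereal_top)
  fix B
  obtain S X where "max 0 B \<le> S" "solves_ivp F x S X"
    using assms[of "max 0 B"] by auto
  then have "ereal S \<le> exit_time F x"
    unfolding exit_time_def by (intro Sup_upper) auto
  with \<open>max 0 B \<le> S\<close> show "ereal B \<le> exit_time F x"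
    by (metis ereal_less_eq(3) max.bounded_iff order_trans)
qed

text \<open>The witnesses in \<open>exit_time\<close> may differ from one horizon to another; by
  uniqueness, the single function \<open>traj F x\<close> agrees with all of them.\<close>

lemma solves_ivp_traj:
  fixes F :: "'a::euclidean_space \<Rightarrow> 'a"
  assumes F: "locally_lipschitz_on UNIV F" and "exit_time F x = \<infinity>" "0 \<le> T"
  shows "solves_ivp F x T (traj F x)"
proof -
  have "ereal T < exit_time F x" using assms by simp
  then obtain S X where "T < S" and X: "solves_ivp F x S X" by (rule less_exit_timeE)
  then have "solves_ivp F x T X"
    by (intro solves_ivp_restrict[OF X]) simp
  then show ?thesis
    by (rule solves_ivp_cong) (use traj_eq[OF F \<open>solves_ivp F x T X\<close>] \<open>0 \<le> T\<close> in blast)+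
qed

lemma traj_0:
  fixes F :: "'a::euclidean_space \<Rightarrow> 'a"
  assumes "locally_lipschitz_on UNIV F" "exit_time F x = \<infinity>"
  shows "traj F x 0 = x"
  using solves_ivp_traj[OF assms, of 0] by (simp add: solves_ivp_def)

lemma traj_add:
  fixes F :: "'a::euclidean_space \<Rightarrow> 'a"
  assumes F: "locally_lipschitz_on UNIV F" and "exit_time F x = \<infinity>" "0 \<le> s" "0 \<le> t"
  shows "traj F (traj F x s) t = traj F x (s + t)"
  using traj_eq[OF F solves_ivp_shift[OF solves_ivp_traj]] assms by auto

text \<open>The length \<open>\<eta>\<close> is the same for every state, so pieces of this length
  can be joined indefinitely.\<close>

lemma exit_time_eq_infinity_if_uniform:
  assumes "0 < \<eta>" and \<eta>: "\<And>x. \<exists>X. solves_ivp F x \<eta> X"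
  shows "exit_time F x = \<infinity>"
proof (rule exit_time_eq_infinityI)
  fix T :: real
  have "\<exists>X. solves_ivp F x (real n * \<eta>) X" for n
  proof (induction n)
    case 0
    then show ?case
      using \<eta>[of x] solves_ivp_restrict[of F x \<eta> _ 0] \<open>0 < \<eta>\<close> by auto
  next
    case (Suc n)
    then obtain X where X: "solves_ivp F x (real n * \<eta>) X" by blast
    obtain Y where "solves_ivp F (X (real n * \<eta>)) \<eta> Y" using \<eta> by blast
    from solves_ivp_join[OF X this] \<open>0 < \<eta>\<close> have "\<exists>Z. solves_ivp F x (real n * \<eta> + \<eta>) Z"
      by auto
    moreover have "real (Suc n) * \<eta> = real n * \<eta> + \<eta>" by (simp add: algebra_simps)
    ultimately show ?case by metis
  qed
  moreover obtain n :: nat where "T < real n * \<eta>"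
    using reals_Archimedean3[OF \<open>0 < \<eta>\<close>] by blast
  ultimately show "\<exists>S\<ge>T. \<exists>X. solves_ivp F x S X"
    using less_imp_le by blast
qed

text \<open>Picard iteration on an interval so short that the Picard operator is a contraction in the
  sup norm; the length does not depend on the initial state.\<close>

lemma solves_ivp_if_lipschitz:
  fixes G :: "'a::euclidean_space \<Rightarrow> 'a"
  assumes G: "L-lipschitz_on UNIV G" and "0 < h" "L * h < 1"
  shows "\<exists>X. solves_ivp G x h X"
proof -
  have contG: "continuous_on S (\<lambda>s. G (apply_bcontfun u s))" for u :: "real \<Rightarrow>\<^sub>C 'a" and S
    using continuous_on_compose2[OF lipschitz_on_continuous_on[OF G] continuous_on_apply_bcontfun]
    by auto
  have "0 \<le> L" using lipschitz_on_nonneg[OF G] .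
  \<comment> \<open>Bounded continuous functions on the whole line form a complete space;
    \<open>clamp\<close> extends the Picard iterate from \<open>{0..h}\<close> by constants to make
    it a member.\<close>
  have "\<exists>P. \<forall>t. apply_bcontfun P t
      = x + integral {0..clamp 0 h t} (\<lambda>s. G (apply_bcontfun u s))" for u :: "real \<Rightarrow>\<^sub>C 'a"
  proof -
    have "continuous_on (cbox 0 h) (\<lambda>t. x + integral {0..t} (\<lambda>s. G (apply_bcontfun u s)))"
      using indefinite_integral_continuous_1[OF integrable_continuous_real[OF contG]]
      by (auto intro!: continuous_intros)
    then show ?thesis by (rule continuous_on_cbox_bcontfunE) auto
  qed
  then obtain P :: "(real \<Rightarrow>\<^sub>C 'a) \<Rightarrow> (real \<Rightarrow>\<^sub>C 'a)" where
    P: "apply_bcontfun (P u) t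
      = x + integral {0..clamp 0 h t} (\<lambda>s. G (apply_bcontfun u s))" for u t
    by metis
  have "dist (P u) (P w) \<le> L * h * dist u w" for u w
  proof (rule dist_bound)
    fix t :: real
    let ?b = "clamp 0 h t"
    have b: "0 \<le> ?b" "?b \<le> h"
      using clamp_in_interval[of 0 h t] \<open>0 < h\<close> by auto
    have "dist (P u t) (P w t)
        = norm (integral {0..?b} (\<lambda>s. G (apply_bcontfun u s) - G (apply_bcontfun w s)))"
      by (simp add: P dist_norm integral_diff[OF integrable_continuous_real[OF contG]
            integrable_continuous_real[OF contG]])
    also have "\<dots> \<le> L * dist u w * (?b - 0)"
    proof (rule integral_bound)
      show "norm (G (apply_bcontfun u s) - G (apply_bcontfun w s)) \<le> L * dist u w" for s
        using lipschitz_onD[OF G, of "u s" "w s"] dist_bounded[of u s w] \<open>0 \<le> L\<close>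
          mult_left_mono[of "dist (u s) (w s)" "dist u w" L]
        by (simp add: dist_norm)
    qed (use b continuous_on_diff[OF contG contG] in auto)
    also have "\<dots> \<le> L * dist u w * h"
      using b \<open>0 \<le> L\<close> by (intro mult_left_mono) auto
    finally show "dist (P u t) (P w t) \<le> L * h * dist u w"
      by (simp add: mult_ac)
  qed
  then obtain u where u: "P u = u"
    using banach_fix_type[of "L * h" P] \<open>0 \<le> L\<close> \<open>0 < h\<close> \<open>L * h < 1\<close> by auto
  \<comment> \<open>On \<open>{0..h}\<close> the clamp is the identity, so the fixed point satisfies
    the integral form of the initial value problem.\<close>
  have ueq: "u t = x + integral {0..t} (\<lambda>s. G (apply_bcontfun u s))" if "t \<in> {0..h}" for t
    using P[of u t] that u by simp
  have "solves_ivp G x h u"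
    unfolding solves_ivp_def
  proof (intro conjI ballI)
    show "u 0 = x" using ueq[of 0] \<open>0 < h\<close> by simp
    fix t assume t: "t \<in> {0..h}"
    have "((\<lambda>t. x + integral {0..t} (\<lambda>s. G (apply_bcontfun u s)))
        has_vector_derivative (0 + G (u t))) (at t within {0..h})"
      by (intro has_vector_derivative_add has_vector_derivative_const
          integral_has_vector_derivative contG t)
    then show "(u has_vector_derivative G (u t)) (at t within {0..h})"
      using has_vector_derivative_transform[OF t ueq] by simp
  qed
  then show ?thesis by blast
qed

text \<open>The step \<open>1 / (L + 1)\<close> makes \<open>L * h < 1\<close> even when
  \<open>L = 0\<close>.\<close>

lemma exit_time_eq_infinity_if_lipschitz:
  fixes G :: "'a::euclidean_space \<Rightarrow> 'a"
  assumes "L-lipschitz_on UNIV G"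
  shows "exit_time G x = \<infinity>"
proof -
  have "0 \<le> L" using lipschitz_on_nonneg[OF assms] .
  have "\<exists>X. solves_ivp G x (1 / (L + 1)) X" for x
    by (rule solves_ivp_if_lipschitz[OF assms]) (use \<open>0 \<le> L\<close> in auto)
  then show ?thesis
    by (rule exit_time_eq_infinity_if_uniform[rotated]) (use \<open>0 \<le> L\<close> in auto)
qed

text \<open>Composing \<open>F\<close> with the projection onto a large ball gives a globally Lipschitz field, whose
  solution never reaches the sphere, since up to a first hitting time it solves the original
  problem.\<close>

lemma exit_time_eq_infinity_if_bounded:
  fixes F :: "'a::euclidean_space \<Rightarrow> 'a"
  assumes F: "locally_lipschitz_on UNIV F"
    and bound: "\<And>T. 0 \<le> T \<Longrightarrow> \<exists>R. \<forall>S X. 0 \<le> S \<longrightarrow> S \<le> T \<longrightarrow> solves_ivp F x S X \<longrightarrow> norm (X S) < R"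
  shows "exit_time F x = \<infinity>"
proof (rule exit_time_eq_infinityI)
  fix T :: real assume "0 \<le> T"
  obtain R where R: "\<And>S X. 0 \<le> S \<Longrightarrow> S \<le> T \<Longrightarrow> solves_ivp F x S X \<Longrightarrow> norm (X S) < R"
    using bound[OF \<open>0 \<le> T\<close>] by blast
  \<comment> \<open>On the degenerate interval \<open>{0..0}\<close> a constant is a solution; the a
    priori bound applied to it places \<open>x\<close> strictly inside the ball.\<close>
  have "solves_ivp F x 0 (\<lambda>_. x)"
    by (simp add: solves_ivp_def has_vector_derivative_def has_derivative_def bounded_linear_scaleR_left
        at_within_def)
  from R[OF order_refl \<open>0 \<le> T\<close> this] have "norm x < R" .
  then have "0 < R" using norm_ge_zero[of x] by linarith
  let ?K = "cball (0::'a) R"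
  have "compact ?K" by simp
  obtain L where L: "L-lipschitz_on ?K F"
    using locally_lipschitz_on_compact[OF F \<open>compact ?K\<close>] by blast
  define G where "G = (\<lambda>y. F (closest_point ?K y))"
  have K: "convex ?K" "closed ?K" "?K \<noteq> {}" using \<open>0 < R\<close> by auto
  have "1-lipschitz_on UNIV (closest_point ?K)"
    by (rule lipschitz_onI) (use closest_point_lipschitz[OF K] in auto)
  moreover have "L-lipschitz_on (range (closest_point ?K)) F"
    by (rule lipschitz_on_subset[OF L]) (use closest_point_in_set[OF K(2,3)] in blast)
  ultimately have G: "(L * 1)-lipschitz_on UNIV G"
    unfolding G_def by (rule lipschitz_on_compose2)
  have GF: "G y = F y" if "norm y \<le> R" for y
    using that by (simp add: G_def closest_point_self)
  obtain S Y where "T < S" and Y: "solves_ivp G x S Y"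
    by (rule less_exit_timeE[of T G x]) (auto simp: exit_time_eq_infinity_if_lipschitz[OF G])
  have solF: "solves_ivp F x s Y" if "0 \<le> s" "s \<le> T" "\<And>r. r \<in> {0..s} \<Longrightarrow> norm (Y r) \<le> R" for s
    using solves_ivp_restrict[OF Y, of s] that \<open>T < S\<close> GF by (simp add: solves_ivp_def)
  have Ybound: "norm (Y t) < R" if t: "t \<in> {0..T}" for t
  proof (rule ccontr)
    assume "\<not> norm (Y t) < R"
    \<comment> \<open>The least element \<open>s\<close> of this compact set is the first time at
      which the solution fails to be strictly inside the ball.\<close>
    define A where "A = {s \<in> {0..t}. R \<le> norm (Y s)}"
    have cont: "continuous_on {0..t} Y"
      using continuous_on_subset[OF solves_ivp_continuous_on[OF Y]] t \<open>T < S\<close> by auto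
    have "closed ({0..t} \<inter> (\<lambda>s. norm (Y s)) -` {R..})"
      by (intro continuous_closed_preimage continuous_on_norm cont) auto
    also have "{0..t} \<inter> (\<lambda>s. norm (Y s)) -` {R..} = A"
      by (auto simp: A_def)
    finally have "compact A"
      by (rule compact_Icc[THEN compact_Int_closed, of A 0 t, THEN back_subst[of compact]])
        (auto simp: A_def)
    moreover have "t \<in> A"
      using t \<open>\<not> norm (Y t) < R\<close> by (simp add: A_def)
    ultimately obtain s where s: "s \<in> A" "\<And>r. r \<in> A \<Longrightarrow> s \<le> r"
      using compact_attains_inf[of A] by auto
    have below: "norm (Y r) < R" if "r \<in> {0..<s}" for r
      using that s by (force simp: A_def)
    have "Y 0 = x" using Y by (simp add: solves_ivp_def)
    \<comment> \<open>The norm takes the value \<open>R\<close> somewhere on \<open>{0..s}\<close>,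
      by minimality only at \<open>s\<close>. Hence \<open>Y\<close> stays in the closed ball up to
      and including \<open>s\<close> and solves the original problem there, so the strict bound
      applies at \<open>s\<close>.\<close>
    have "continuous_on {0..s} (\<lambda>r. norm (Y r))"
      using s by (intro continuous_on_norm continuous_on_subset[OF cont]) (auto simp: A_def)
    then obtain r where "0 \<le> r" "r \<le> s" "norm (Y r) = R"
      using IVT'[of "\<lambda>r. norm (Y r)" 0 R s] s \<open>norm x < R\<close> \<open>Y 0 = x\<close>
      by (auto simp: A_def)
    moreover from this s have "r = s"
      by (force simp: A_def)
    ultimately have "norm (Y q) \<le> R" if "q \<in> {0..s}" for q
      using that below[of q] by (cases "q = s") auto
    then have "solves_ivp F x s Y"
      using s t by (intro solF) (auto simp: A_def)
    from R[OF _ _ this] s t show False by (auto simp: A_def)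
  qed
  have "solves_ivp F x T Y"
    using solF[OF \<open>0 \<le> T\<close>] Ybound less_imp_le by blast
  then show "\<exists>S\<ge>T. \<exists>X. solves_ivp F x S X" by blast
qed

section \<open>Gradients along solutions\<close>

text \<open>\<open>adjoint v' 1\<close> is the vector that represents the functional
  \<open>v'\<close> by the inner product; uniqueness of derivatives identifies it with
  \<open>grad v x\<close>.\<close>

lemma has_derivative_grad:
  fixes v :: "'a::euclidean_space \<Rightarrow> real"
  assumes "v differentiable (at x)"
  shows "(v has_derivative (\<lambda>h. h \<bullet> grad v x)) (at x)"
proof -
  obtain v' where v': "(v has_derivative v') (at x)"
    using assms unfolding differentiable_def by blast
  have "v' = (\<lambda>h. h \<bullet> adjoint v' 1)"
    using adjoint_works[OF has_derivative_linear[OF v'], of _ 1] by (auto simp: fun_eq_iff)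
  with v' have D: "GDERIV v x :> adjoint v' 1"
    by (simp add: gderiv_def)
  have "grad v x = adjoint v' 1"
    unfolding grad_def
  proof (rule the_equality)
    fix E assume "GDERIV v x :> E"
    from has_derivative_unique[OF this[unfolded gderiv_def] D[unfolded gderiv_def]]
    show "E = adjoint v' 1"
      by (auto simp: fun_eq_iff intro!: vector_eq_ldot[THEN iffD1])
  qed (rule D)
  with D show ?thesis
    by (simp add: gderiv_def)
qed

text \<open>Chain and product rule; the bracket is the expression that the differential Bellman
  equation equates with the running cost.\<close>

lemma has_vector_derivative_discounted_along_solution:
  fixes v :: "'a::euclidean_space \<Rightarrow> real"
  assumes "v differentiable (at (X t))" "solves_ivp F x T X" "t \<in> {0..T}" "0 < \<gamma>"
  shows "((\<lambda>t. \<gamma> powr t * v (X t)) has_vector_derivative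
      \<gamma> powr t * (ln \<gamma> * v (X t) + grad v (X t) \<bullet> F (X t))) (at t within {0..T})"
proof -
  have "(X has_vector_derivative F (X t)) (at t within {0..T})"
    using assms by (auto simp: solves_ivp_def)
  from vector_derivative_diff_chain_within[OF this
      has_derivative_at_withinI[OF has_derivative_grad[OF assms(1)]]]
  have 1: "((\<lambda>t. v (X t)) has_vector_derivative F (X t) \<bullet> grad v (X t)) (at t within {0..T})"
    by (simp add: o_def)
  have 2: "((\<lambda>t. exp (t * ln \<gamma>)) has_vector_derivative exp (t * ln \<gamma>) * ln \<gamma>) (at t within {0..T})"
    by (auto intro!: derivative_eq_intros simp: has_real_derivative_iff_has_vector_derivative[symmetric])
  show ?thesis
    using has_vector_derivative_mult[OF 2 1] \<open>0 < \<gamma>\<close>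
    by (simp add: powr_def algebra_simps inner_commute)
qed

text \<open>If \<open>D\<close> were nonzero, the difference quotient \<open>d t / t\<close> would
  be nonzero for all small positive \<open>t\<close>, contradicting the zeros of \<open>d\<close>
  that accumulate at 0.\<close>

lemma vector_derivative_eq_0_if_frequently_0:
  fixes d :: "real \<Rightarrow> real"
  assumes d: "(d has_vector_derivative D) (at 0 within {0..b})" and "0 < b" "d 0 = 0"
    and freq: "\<And>\<epsilon>. \<epsilon> > 0 \<Longrightarrow> \<exists>\<eta>. 0 < \<eta> \<and> \<eta> < \<epsilon> \<and> d \<eta> = 0"
  shows "D = 0"
proof (rule ccontr)
  assume "D \<noteq> 0"
  have "((\<lambda>t. d t / t) \<longlongrightarrow> D) (at 0 within {0..b})"
    using d \<open>d 0 = 0\<close>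
    by (simp add: has_real_derivative_iff_has_vector_derivative[symmetric] has_field_derivative_iff)
  from tendsto_imp_eventually_ne[OF this \<open>D \<noteq> 0\<close>]
  obtain \<delta> where "\<delta> > 0" "\<And>t. t \<in> {0..b} \<Longrightarrow> t \<noteq> 0 \<Longrightarrow> dist t 0 < \<delta> \<Longrightarrow> d t / t \<noteq> 0"
    unfolding eventually_at by blast
  with freq[of "min \<delta> b"] \<open>0 < b\<close> show False
    by fastforce
qed

section \<open>Consequences of the Bellman equations\<close>

text \<open>Once the infimum of \<open>\<bar>g x\<bar>\<close> outside some ball exceeds
  \<open>M\<close>, the sublevel set lies inside that ball. This turns a bound on the value along
  solutions into a bound on the state.\<close>

lemma radially_unbounded_bounded_sublevel:
  assumes "radially_unbounded g"
  obtains R where "\<And>x. \<bar>g x\<bar> \<le> M \<Longrightarrow> norm x < R"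
proof -
  have "eventually (\<lambda>\<rho>. M < outer_inf g \<rho>) at_top"
    using assms unfolding radially_unbounded_def filterlim_at_top_dense by blast
  then obtain \<rho> where \<rho>: "M < outer_inf g \<rho>"
    using eventually_happens' trivial_limit_at_top_linorder by blast
  have "norm x < \<rho>" if "\<bar>g x\<bar> \<le> M" for x
  proof (rule ccontr)
    assume "\<not> norm x < \<rho>"
    then have "outer_inf g \<rho> \<le> \<bar>g x\<bar>"
      unfolding outer_inf_def by (intro cINF_lower bdd_belowI2[of _ 0]) auto
    with \<rho> that show False by simp
  qed
  then show ?thesis by (rule that)
qed

lemma closed_loop_reward: "closed_loop (reward c) \<pi> x = - closed_loop c \<pi> x"
  by (simp add: closed_loop_def reward_def)

section \<open>Consequences of the differential Bellman equation\<close>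

lemma differential_bellman_iff:
  "differential_bellman f c \<gamma> \<pi> v \<longleftrightarrow>
    (\<forall>x. ln \<gamma> * v x + grad v x \<bullet> closed_loop f \<pi> x = closed_loop c \<pi> x)"
  unfolding differential_bellman_def hamiltonian_def reward_def closed_loop_def
  by (intro all_cong1) auto

text \<open>Under the differential equation the discounted cost is the time derivative of
  \<open>\<gamma> powr t * v (X t)\<close>.\<close>

lemma differential_bellman_has_integral:
  assumes "differential_bellman f c \<gamma> \<pi> v" "\<And>x. v differentiable (at x)" "0 < \<gamma>"
    and X: "solves_ivp (closed_loop f \<pi>) x T X" and "0 \<le> T"
  shows "((\<lambda>t. \<gamma> powr t * closed_loop c \<pi> (X t)) has_integral \<gamma> powr T * v (X T) - v x) {0..T}"
proof -
  have "((\<lambda>t. \<gamma> powr t * v (X t)) has_vector_derivative \<gamma> powr t * closed_loop c \<pi> (X t))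
      (at t within {0..T})" if "t \<in> {0..T}" for t
    using has_vector_derivative_discounted_along_solution[OF assms(2) X that \<open>0 < \<gamma>\<close>]
      assms(1) by (simp add: differential_bellman_iff)
  from fundamental_theorem_of_calculus[OF \<open>0 \<le> T\<close> this] X \<open>0 < \<gamma>\<close> show ?thesis
    by (simp add: solves_ivp_def)
qed

text \<open>With the integrating factor \<open>exp (\<kappa> * t)\<close>, the discounted value has
  a derivative of the sign of \<open>closed_loop c \<pi> (X t) + \<kappa> * v (X t)\<close>, which
  is nonnegative by the bound on the cost.\<close>

lemma differential_bellman_decay:
  assumes "differential_bellman f c \<gamma> \<pi> v" "\<And>x. v differentiable (at x)" "0 < \<gamma>"
    and X: "solves_ivp (closed_loop f \<pi>) x T X" and "0 \<le> T"
    and \<kappa>: "\<And>x. \<kappa> * (- v x) \<le> closed_loop c \<pi> x"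
  shows "\<gamma> powr T * (- v (X T)) \<le> exp (- \<kappa> * T) * (- v x)"
proof -
  define w where "w = (\<lambda>t. \<gamma> powr t * v (X t))"
  have "exp (\<kappa> * 0) * w 0 \<le> exp (\<kappa> * T) * w T"
  proof (rule vector_derivative_nonneg_imp_le[where g = "\<lambda>t. exp (\<kappa> * t) * w t"
        and g' = "\<lambda>t. exp (\<kappa> * t) * (\<gamma> powr t * (closed_loop c \<pi> (X t) + \<kappa> * v (X t)))"])
    fix t assume t: "t \<in> {0..T}"
    have 1: "(w has_vector_derivative \<gamma> powr t * closed_loop c \<pi> (X t)) (at t within {0..T})"
      using has_vector_derivative_discounted_along_solution[OF assms(2) X t \<open>0 < \<gamma>\<close>]
        assms(1) by (simp add: differential_bellman_iff w_def)
    have 2: "((\<lambda>t. exp (\<kappa> * t)) has_vector_derivative exp (\<kappa> * t) * \<kappa>) (at t within {0..T})"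
      by (auto intro!: derivative_eq_intros
          simp: has_real_derivative_iff_has_vector_derivative[symmetric])
    show "((\<lambda>t. exp (\<kappa> * t) * w t) has_vector_derivative
        exp (\<kappa> * t) * (\<gamma> powr t * (closed_loop c \<pi> (X t) + \<kappa> * v (X t)))) (at t within {0..T})"
      using has_vector_derivative_mult[OF 2 1] by (simp add: w_def algebra_simps)
    show "0 \<le> exp (\<kappa> * t) * (\<gamma> powr t * (closed_loop c \<pi> (X t) + \<kappa> * v (X t)))"
      using \<kappa>[of "X t"] by simp
  qed fact
  moreover have "w 0 = v x"
    using X \<open>0 < \<gamma>\<close> by (simp add: w_def solves_ivp_def)
  ultimately have "v x \<le> exp (\<kappa> * T) * w T" by simp
  then have "exp (- \<kappa> * T) * v x \<le> exp (- \<kappa> * T) * (exp (\<kappa> * T) * w T)"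
    by (intro mult_left_mono) auto
  also have "\<dots> = w T"
    by (simp add: exp_minus)
  finally show ?thesis
    by (simp add: w_def)
qed

text \<open>By the decay estimate, all solutions from \<open>x\<close> up to time \<open>T\<close>
  stay in one sublevel set of \<open>- v\<close>, which is bounded; so blow-up is
  impossible.\<close>

lemma exit_time_eq_infinity_if_differential_bellman:
  assumes F: "locally_lipschitz_on UNIV (closed_loop f \<pi>)"
    and bell: "differential_bellman f c \<gamma> \<pi> v" "\<And>x. v differentiable (at x)"
    and \<gamma>: "0 < \<gamma>" "\<gamma> \<le> 1" and "0 \<le> \<kappa>" "\<And>x. \<kappa> * (- v x) \<le> closed_loop c \<pi> x"
    and v: "radially_unbounded v" "\<And>x. v x \<le> 0"
  shows "exit_time (closed_loop f \<pi>) x = \<infinity>"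
proof (rule exit_time_eq_infinity_if_bounded[OF F])
  fix T :: real assume "0 \<le> T"
  obtain R where R: "\<And>y. \<bar>v y\<bar> \<le> - v x / \<gamma> powr T \<Longrightarrow> norm y < R"
    using radially_unbounded_bounded_sublevel[OF v(1)] by blast
  have "norm (X S) < R" if "0 \<le> S" "S \<le> T" "solves_ivp (closed_loop f \<pi>) x S X" for S X
  proof (rule R)
    \<comment> \<open>Replacing \<open>S\<close> by \<open>T\<close> in the discount, as
      \<open>\<gamma> \<le> 1\<close> permits, makes the bound the same for all
      \<open>S \<le> T\<close>.\<close>
    have "\<gamma> powr T * (- v (X S)) \<le> \<gamma> powr S * (- v (X S))"
      using v(2)[of "X S"] \<gamma> \<open>S \<le> T\<close> by (intro mult_right_mono powr_mono') auto
    also have "\<dots> \<le> exp (- \<kappa> * S) * (- v x)"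
      by (rule differential_bellman_decay) (use assms that in auto)
    also have "\<dots> \<le> 1 * (- v x)"
      using v(2)[of x] \<open>0 \<le> \<kappa>\<close> \<open>0 \<le> S\<close> by (intro mult_right_mono) auto
    finally show "\<bar>v (X S)\<bar> \<le> - v x / \<gamma> powr T"
      using v(2)[of "X S"] \<gamma> by (simp add: pos_divide_le_eq mult.commute)
  qed
  then show "\<exists>R. \<forall>S X. 0 \<le> S \<longrightarrow> S \<le> T \<longrightarrow> solves_ivp (closed_loop f \<pi>) x S X \<longrightarrow> norm (X S) < R"
    by blast
qed

section \<open>Consequences of the integral Bellman equation\<close>

lemma exit_time_eq_infinity_if_integral_bellman:
  assumes "integral_bellman f c \<gamma> \<pi> v \<eta>" "0 < \<eta>"
  shows "exit_time (closed_loop f \<pi>) x = \<infinity>"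
proof (rule exit_time_eq_infinity_if_uniform[OF \<open>0 < \<eta>\<close>])
  fix y
  have "ereal \<eta> < exit_time (closed_loop f \<pi>) y"
    using assms by (simp add: integral_bellman_def)
  then obtain T X where "\<eta> < T" "solves_ivp (closed_loop f \<pi>) y T X"
    by (rule less_exit_timeE)
  then show "\<exists>X. solves_ivp (closed_loop f \<pi>) y \<eta> X"
    using solves_ivp_restrict less_imp_le by blast
qed

lemma continuous_on_traj:
  fixes F :: "'a::euclidean_space \<Rightarrow> 'a"
  assumes "locally_lipschitz_on UNIV F" "exit_time F x = \<infinity>"
  shows "continuous_on {0..} (traj F x)"
  unfolding continuous_on_eq_continuous_within
proof
  fix t :: real assume t: "t \<in> {0..}"
  \<comment> \<open>Continuity is known on compact intervals only; the extra unit of time makes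
    \<open>{0..t + 1}\<close> a neighbourhood of \<open>t\<close> in the half-line.\<close>
  have "at t within {0..t + 1} = at t within {0..}"
    by (rule at_within_nhd[of t "{..<t + 1}"]) auto
  moreover have "continuous_on {0..t + 1} (traj F x)"
    using solves_ivp_continuous_on[OF solves_ivp_traj[OF assms]] t by auto
  ultimately show "continuous (at t within {0..}) (traj F x)"
    using t unfolding continuous_on_eq_continuous_within
    by (metis atLeastAtMost_iff atLeast_iff less_add_one less_imp_le)
qed

lemma continuous_on_discounted_along_traj:
  fixes F :: "'a::euclidean_space \<Rightarrow> 'a"
  assumes "locally_lipschitz_on UNIV F" "exit_time F x = \<infinity>" "continuous_on UNIV k" "0 < \<gamma>"
  shows "continuous_on {0..} (\<lambda>t. \<gamma> powr t * k (traj F x t) :: real)"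
  using continuous_on_compose2[OF \<open>continuous_on UNIV k\<close> continuous_on_traj[OF assms(1,2)]]
    \<open>0 < \<gamma>\<close> by (auto intro!: continuous_intros)

lemma integral_bellman_has_integral:
  assumes F: "locally_lipschitz_on UNIV (closed_loop f \<pi>)"
    and c: "continuous_on UNIV (closed_loop c \<pi>)"
    and bell: "integral_bellman f c \<gamma> \<pi> v \<eta>" and "0 < \<eta>" "0 < \<gamma>"
  shows "((\<lambda>t. \<gamma> powr t * closed_loop c \<pi> (traj (closed_loop f \<pi>) x t)) has_integral
      \<gamma> powr \<eta> * v (traj (closed_loop f \<pi>) x \<eta>) - v x) {0..\<eta>}"
proof -
  let ?g = "\<lambda>t. \<gamma> powr t * closed_loop c \<pi> (traj (closed_loop f \<pi>) x t)"
  note ext = exit_time_eq_infinity_if_integral_bellman[OF bell \<open>0 < \<eta>\<close>]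
  \<comment> \<open>\<open>integral\<close> defaults to 0 for a nonintegrable function, so
    integrability has to come from continuity before the equation can be read as a statement about
    \<open>has_integral\<close>.\<close>
  have "continuous_on {0..\<eta>} ?g"
    using continuous_on_discounted_along_traj[OF F ext c \<open>0 < \<gamma>\<close>]
    by (rule continuous_on_subset) auto
  from integrable_integral[OF integrable_continuous_real[OF this]]
  have "(?g has_integral integral {0..\<eta>} ?g) {0..\<eta>}" .
  moreover have "v x = - integral {0..\<eta>} ?g + \<gamma> powr \<eta> * v (traj (closed_loop f \<pi>) x \<eta>)"
    using bell[unfolded integral_bellman_def closed_loop_reward, rule_format, of x, THEN conjunct2]
    by (simp only: mult_minus_right integral_neg)
  then have "integral {0..\<eta>} ?g = \<gamma> powr \<eta> * v (traj (closed_loop f \<pi>) x \<eta>) - v x"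
    by linarith
  ultimately show ?thesis
    by simp
qed

text \<open>The equation at the state reached at time \<open>real n * \<eta>\<close>, discounted
  back to time 0, covers the next interval of length \<open>\<eta>\<close>; the terminal values
  telescope.\<close>

lemma integral_bellman_has_integral_multiple:
  assumes F: "locally_lipschitz_on UNIV (closed_loop f \<pi>)"
    and c: "continuous_on UNIV (closed_loop c \<pi>)"
    and bell: "integral_bellman f c \<gamma> \<pi> v \<eta>" and "0 < \<eta>" "0 < \<gamma>"
  shows "((\<lambda>t. \<gamma> powr t * closed_loop c \<pi> (traj (closed_loop f \<pi>) x t)) has_integral
      \<gamma> powr (real n * \<eta>) * v (traj (closed_loop f \<pi>) x (real n * \<eta>)) - v x) {0..real n * \<eta>}"
proof (induction n)
  note ext = exit_time_eq_infinity_if_integral_bellman[OF bell \<open>0 < \<eta>\<close>]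
  case 0
  then show ?case
    using traj_0[OF F ext] \<open>0 < \<gamma>\<close> by (simp add: has_integral_refl)
next
  let ?X = "traj (closed_loop f \<pi>)"
  let ?g = "\<lambda>t. \<gamma> powr t * closed_loop c \<pi> (?X x t)"
  note ext = exit_time_eq_infinity_if_integral_bellman[OF bell \<open>0 < \<eta>\<close>]
  case (Suc n)
  let ?s = "real n * \<eta>"
  have s: "0 \<le> ?s" "0 \<le> \<eta>" "real (Suc n) * \<eta> = \<eta> + ?s"
    using \<open>0 < \<eta>\<close> by (simp_all add: algebra_simps)
  have "((\<lambda>t. \<gamma> powr ?s * (\<gamma> powr t * closed_loop c \<pi> (?X (?X x ?s) t))) has_integral
      \<gamma> powr ?s * (\<gamma> powr \<eta> * v (?X (?X x ?s) \<eta>) - v (?X x ?s))) {0..\<eta>}"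
    by (intro has_integral_mult_right integral_bellman_has_integral assms)
  also have "\<gamma> powr ?s * (\<gamma> powr \<eta> * v (?X (?X x ?s) \<eta>) - v (?X x ?s))
      = \<gamma> powr (\<eta> + ?s) * v (?X x (\<eta> + ?s)) - \<gamma> powr ?s * v (?X x ?s)"
    using s by (simp add: traj_add[OF F ext] powr_add algebra_simps)
  finally have "((?g \<circ> (+) ?s) has_integral
      \<gamma> powr (\<eta> + ?s) * v (?X x (\<eta> + ?s)) - \<gamma> powr ?s * v (?X x ?s)) {0..\<eta>}"
    by (rule has_integral_eq[rotated])
      (use s in \<open>simp add: traj_add[OF F ext] powr_add\<close>)
  then have "(?g has_integral
      \<gamma> powr (\<eta> + ?s) * v (?X x (\<eta> + ?s)) - \<gamma> powr ?s * v (?X x ?s)) {?s..\<eta> + ?s}"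
    by (simp add: has_integral_shift_Icc_real)
  from has_integral_combine[OF _ _ Suc.IH this] s show ?case
    by (simp add: algebra_simps)
qed

text \<open>Letting the horizon tend to \<open>0\<close> differentiates the integral equation at the initial time.\<close>

lemma differential_bellman_if_integral_bellman:
  assumes F: "locally_lipschitz_on UNIV (closed_loop f \<pi>)"
    and c: "continuous_on UNIV (closed_loop c \<pi>)"
    and v: "\<And>x. v differentiable (at x)" and "0 < \<gamma>"
    and bell: "\<forall>\<epsilon>>0. \<exists>\<eta>. 0 < \<eta> \<and> \<eta> < \<epsilon> \<and> integral_bellman f c \<gamma> \<pi> v \<eta>"
  shows "differential_bellman f c \<gamma> \<pi> v"
  unfolding differential_bellman_iff
proof
  fix x
  let ?F = "closed_loop f \<pi>" and ?k = "closed_loop c \<pi>"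
  define X where "X = traj ?F x"
  let ?g = "\<lambda>t. \<gamma> powr t * ?k (X t)"
  have ext: "exit_time ?F x = \<infinity>"
    using bell exit_time_eq_infinity_if_integral_bellman zero_less_one by blast
  have X0: "X 0 = x" and X: "solves_ivp ?F x 1 X"
    using traj_0[OF F ext] solves_ivp_traj[OF F ext, of 1] by (simp_all add: X_def)
  have cont: "continuous_on {0..1} ?g"
    unfolding X_def using continuous_on_discounted_along_traj[OF F ext c \<open>0 < \<gamma>\<close>]
    by (rule continuous_on_subset) auto
  \<comment> \<open>\<open>d\<close> is the defect of the integral equation as a function of the
    horizon. It vanishes at arbitrarily small horizons, and its derivative at 0 is the defect of the
    differential equation at \<open>x\<close>.\<close>
  define d where "d t = (\<gamma> powr t * v (X t) - v x) - integral {0..t} ?g" for t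
  have "(d has_vector_derivative
      (\<gamma> powr 0 * (ln \<gamma> * v (X 0) + grad v (X 0) \<bullet> ?F (X 0)) - 0) - ?g 0) (at 0 within {0..1})"
    unfolding d_def
    by (intro has_vector_derivative_diff has_vector_derivative_const
        has_vector_derivative_discounted_along_solution[OF v X _ \<open>0 < \<gamma>\<close>]
        integral_has_vector_derivative[OF cont]) auto
  moreover have "d 0 = 0"
    using X0 \<open>0 < \<gamma>\<close> by (simp add: d_def)
  moreover have "\<exists>\<eta>. 0 < \<eta> \<and> \<eta> < \<epsilon> \<and> d \<eta> = 0" if \<epsilon>: "\<epsilon> > 0" for \<epsilon>
  proof -
    obtain \<eta> where \<eta>: "0 < \<eta>" "\<eta> < \<epsilon>" "integral_bellman f c \<gamma> \<pi> v \<eta>"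
      using bell \<epsilon> by blast
    have "d \<eta> = 0"
      using integral_unique[OF integral_bellman_has_integral[OF F c \<eta>(3,1) \<open>0 < \<gamma>\<close>]]
      by (simp add: d_def X_def)
    with \<eta> show ?thesis by blast
  qed
  ultimately have "(\<gamma> powr 0 * (ln \<gamma> * v (X 0) + grad v (X 0) \<bullet> ?F (X 0)) - 0) - ?g 0 = 0"
    using vector_derivative_eq_0_if_frequently_0 zero_less_one by blast
  then show "ln \<gamma> * v x + grad v x \<bullet> ?F x = ?k x"
    using X0 \<open>0 < \<gamma>\<close> by simp
qed

section \<open>Passage to the infinite horizon\<close>

lemma exp_multiple_tendsto_0:
  assumes "a < 0" "0 < \<eta>"
  shows "(\<lambda>n. exp (a * (real n * \<eta>))) \<longlonglongrightarrow> 0"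
proof -
  have "(\<lambda>n. exp (a * \<eta>) ^ n) \<longlonglongrightarrow> 0"
    using assms by (intro LIMSEQ_realpow_zero) (auto simp: mult_neg_pos)
  moreover have "exp (a * (real n * \<eta>)) = exp (a * \<eta>) ^ n" for n
    using exp_of_nat_mult[of n "a * \<eta>"] by (simp add: mult_ac)
  ultimately show ?thesis by simp
qed

text \<open>Monotone convergence for the truncations \<open>h n\<close>: they increase because
  \<open>g\<close> is nonnegative, and at each fixed \<open>t\<close> they are eventually constant.
  Hence horizons along the multiples of \<open>\<eta>\<close> suffice.\<close>

lemma nn_integral_atLeast_eq_limit:
  fixes g :: "real \<Rightarrow> real"
  assumes "continuous_on {0..} g" "\<And>t. 0 \<le> t \<Longrightarrow> 0 \<le> g t" "0 < \<eta>"
    and int: "\<And>n. (g has_integral a n) {0..real n * \<eta>}" and lim: "a \<longlonglongrightarrow> l"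
  shows "(\<integral>\<^sup>+t\<in>{0..}. ennreal (g t) \<partial>lborel) = ennreal l"
proof -
  define h where "h n t = indicator {0..real n * \<eta>} t * g t" for n t
  have meas: "h n \<in> borel_measurable borel" for n
    unfolding h_def
    using borel_measurable_continuous_on_indicator[OF _ continuous_on_subset[OF assms(1)],
        of "{0..real n * \<eta>}"] by auto
  have nonneg: "0 \<le> h n t" for n t
    using assms(2) by (auto simp: h_def indicator_def)
  have "integral\<^sup>N lborel (\<lambda>t. ennreal (h n t)) = ennreal (a n)" for n
  proof (rule nn_integral_has_integral_lborel[OF meas nonneg])
    show "(h n has_integral a n) UNIV"
      using int[of n] has_integral_restrict_UNIV[of "{0..real n * \<eta>}" g "a n"]
      by (simp add: h_def[abs_def] indicator_def of_bool_def if_distrib[of "\<lambda>b. b * _"]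
          cong: if_cong)
  qed
  moreover have "(\<lambda>n. integral\<^sup>N lborel (\<lambda>t. ennreal (h n t)))
      \<longlonglongrightarrow> (\<integral>\<^sup>+t\<in>{0..}. ennreal (g t) \<partial>lborel)"
  proof (rule nn_integral_LIMSEQ)
    show "incseq (\<lambda>n t. ennreal (h n t))"
    proof (intro incseq_SucI le_funI ennreal_leI)
      fix n t
      have "real n * \<eta> \<le> real (Suc n) * \<eta>"
        using \<open>0 < \<eta>\<close> by simp
      then show "h n t \<le> h (Suc n) t"
        using assms(2)[of t] by (auto simp: h_def indicator_def)
    qed
    show "(\<lambda>t. ennreal (h n t)) \<in> borel_measurable lborel" for n
      using meas[of n] by auto
    fix t
    obtain N :: nat where N: "t < real N * \<eta>"
      using reals_Archimedean3[OF \<open>0 < \<eta>\<close>] by blast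
    have "h n t = indicator {0..} t * g t" if "n \<ge> N" for n
    proof -
      have "real N * \<eta> \<le> real n * \<eta>" using that \<open>0 < \<eta>\<close> by simp
      with N show ?thesis by (auto simp: h_def indicator_def)
    qed
    then have "eventually (\<lambda>n. ennreal (g t) * indicator {0..} t = ennreal (h n t)) sequentially"
      unfolding eventually_sequentially by (intro exI[of _ N]) (auto simp: indicator_def)
    then show "(\<lambda>n. ennreal (h n t)) \<longlonglongrightarrow> ennreal (g t) * indicator {0..} t"
      by (rule tendsto_eventually[OF eventually_mono]) auto
  qed
  ultimately show ?thesis
    using LIMSEQ_unique tendsto_ennrealI[OF lim] by auto
qed

theorem theorem5p17:
  fixes U :: "(real^'m) set"
    and f :: "real^'l \<Rightarrow> real^'m \<Rightarrow> real^'l"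
    and c :: "real^'l \<Rightarrow> real^'m \<Rightarrow> real"
    and \<gamma> \<kappa> :: real
    and \<pi> :: "real^'l \<Rightarrow> real^'m"
    and v :: "real^'l \<Rightarrow> real"
  assumes "optimal_control U f c \<gamma>"
    and "\<pi> \<in> policies0 U"
    and "positive_definite (\<lambda>x. - v x)"
    and "\<kappa> > 0"
    and "\<And>x. \<kappa> * (- v x) \<le> closed_loop c \<pi> x"
    and "(is_C1 v \<and> radially_unbounded v \<and>
            (differential_bellman f c \<gamma> \<pi> v \<or>
             (\<forall>\<epsilon>>0. \<exists>\<eta>. 0 < \<eta> \<and> \<eta> < \<epsilon> \<and> integral_bellman f c \<gamma> \<pi> v \<eta>)))
         \<or>
         ((\<exists>\<eta>>0. integral_bellman f c \<gamma> \<pi> v \<eta>) \<and>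
          radially_unbounded (closed_loop c \<pi>) \<and>
          (\<exists>(\<zeta> :: real^'l \<Rightarrow> real) (\<alpha>' :: real). \<alpha>' < - ln \<gamma> \<and>
             (\<forall>x t. 0 \<le> t \<and> ereal t < exit_time (closed_loop f \<pi>) x \<longrightarrow>
                closed_loop c \<pi> (traj (closed_loop f \<pi>) x t) \<le> \<zeta> x * exp (\<alpha>' * t))))"
  shows "\<pi> \<in> admissible_policies U f c \<gamma> \<and> (\<forall>x. ereal (v x) = value_fn f c \<gamma> \<pi> x)"
proof -
  let ?F = "closed_loop f \<pi>" and ?k = "closed_loop c \<pi>"
  interpret optimal_control U f c \<gamma> by fact
  have \<pi>: "continuous_on UNIV \<pi>" "range \<pi> \<subseteq> U" "locally_lipschitz_on UNIV \<pi>"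
    using \<open>\<pi> \<in> policies0 U\<close> by (auto simp: policies0_def policies_def)
  have F: "locally_lipschitz_on UNIV ?F"
    unfolding closed_loop_def[abs_def]
    using locally_lipschitz_on_compose_Pair[OF dynamics_lipschitz \<pi>(3,2)] .
  have "continuous_on UNIV (\<lambda>x. case (x, \<pi> x) of (x, u) \<Rightarrow> c x u)"
    by (rule continuous_on_compose2[OF cost_continuous])
      (use \<pi> in \<open>auto intro!: continuous_intros\<close>)
  then have k: "continuous_on UNIV ?k"
    by (simp add: closed_loop_def[abs_def])
  have v: "v x \<le> 0" for x
    using \<open>positive_definite (\<lambda>x. - v x)\<close> by (cases "x = 0")
      (auto simp: positive_definite_def less_imp_le)
  have k_nonneg: "0 \<le> ?k x" for x
    using assms(5)[of x] mult_nonneg_nonneg[of \<kappa> "- v x"] v[of x] \<open>\<kappa> > 0\<close> by linarith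

  \<comment> \<open>Both cases are reduced to the same three facts: global existence, the value
    identity on multiples of a step \<open>\<eta>\<close>, and a vanishing discounted terminal
    value. In case (a) any step would do, and 1 is taken.\<close>
  have "\<exists>\<eta>>0. (\<forall>x. exit_time ?F x = \<infinity>) \<and>
    (\<forall>x n. ((\<lambda>t. \<gamma> powr t * ?k (traj ?F x t)) has_integral
      \<gamma> powr (real n * \<eta>) * v (traj ?F x (real n * \<eta>)) - v x) {0..real n * \<eta>}) \<and>
    (\<forall>x. (\<lambda>n. \<gamma> powr (real n * \<eta>) * v (traj ?F x (real n * \<eta>))) \<longlonglongrightarrow> 0)"
    using assms(6)
  proof (elim disjE[of "is_C1 v \<and> _"] conjE exE)
    assume "is_C1 v" and rad: "radially_unbounded v"
      and bell: "differential_bellman f c \<gamma> \<pi> v \<or>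
        (\<forall>\<epsilon>>0. \<exists>\<eta>. 0 < \<eta> \<and> \<eta> < \<epsilon> \<and> integral_bellman f c \<gamma> \<pi> v \<eta>)"
    then have diff: "v differentiable (at x)" for x
      by (simp add: is_C1_def)
    have bell: "differential_bellman f c \<gamma> \<pi> v"
      using bell differential_bellman_if_integral_bellman[OF F k diff discount(1)] by blast
    have ext: "exit_time ?F x = \<infinity>" for x
      using exit_time_eq_infinity_if_differential_bellman[OF F bell diff discount
          less_imp_le[OF \<open>\<kappa> > 0\<close>] assms(5) rad v] .
    have sol: "solves_ivp ?F x (real n * 1) (traj ?F x)" for x and n :: nat
      by (rule solves_ivp_traj[OF F ext]) simp
    \<comment> \<open>The discounted value is nonpositive and, by the decay estimate, at least
      \<open>exp (- \<kappa> * n) * v x\<close>.\<close>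
    have "(\<lambda>n. \<gamma> powr (real n * 1) * v (traj ?F x (real n * 1))) \<longlonglongrightarrow> 0" for x
    proof (rule tendsto_sandwich)
      show "eventually (\<lambda>n. exp (- \<kappa> * (real n * 1)) * v x
          \<le> \<gamma> powr (real n * 1) * v (traj ?F x (real n * 1))) sequentially"
        using differential_bellman_decay[OF bell diff discount(1) sol[of x] _ assms(5)]
        by (intro always_eventually allI) simp
      show "eventually (\<lambda>n. \<gamma> powr (real n * 1) * v (traj ?F x (real n * 1)) \<le> 0) sequentially"
        using v by (intro always_eventually allI) (simp add: mult_nonneg_nonpos)
      show "(\<lambda>n. exp (- \<kappa> * (real n * 1)) * v x) \<longlonglongrightarrow> 0"
        using \<open>\<kappa> > 0\<close> by (intro tendsto_mult_left_zero exp_multiple_tendsto_0) auto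
    qed simp
    then show ?thesis
      using ext differential_bellman_has_integral[OF bell diff discount(1) sol]
      by (intro exI[of _ 1]) auto
  next
    fix \<eta> \<zeta> \<alpha>'
    assume "0 < \<eta>" and bell: "integral_bellman f c \<gamma> \<pi> v \<eta>" and "\<alpha>' < - ln \<gamma>"
      and growth: "\<forall>x t. 0 \<le> t \<and> ereal t < exit_time ?F x \<longrightarrow> ?k (traj ?F x t) \<le> \<zeta> x * exp (\<alpha>' * t)"
    note ext = exit_time_eq_infinity_if_integral_bellman[OF bell \<open>0 < \<eta>\<close>]
    have "(\<lambda>n. \<gamma> powr (real n * \<eta>) * v (traj ?F x (real n * \<eta>))) \<longlonglongrightarrow> 0" for x
    proof (rule tendsto_sandwich)
      \<comment> \<open>The growth bound and
        \<open>\<kappa> * (- v x) \<le> closed_loop c \<pi> x\<close> bound \<open>- v\<close> by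
        \<open>\<zeta> x / \<kappa> * exp (\<alpha>' * t)\<close>; the discount adds
        \<open>ln \<gamma>\<close> to the rate, which makes it negative.\<close>
      show "eventually (\<lambda>n. - (\<zeta> x / \<kappa>) * exp ((\<alpha>' + ln \<gamma>) * (real n * \<eta>))
          \<le> \<gamma> powr (real n * \<eta>) * v (traj ?F x (real n * \<eta>))) sequentially"
      proof (intro always_eventually allI)
        fix n
        let ?t = "real n * \<eta>"
        have "\<kappa> * (- v (traj ?F x ?t)) \<le> \<zeta> x * exp (\<alpha>' * ?t)"
          using assms(5)[of "traj ?F x ?t"] growth[rule_format, of ?t x] ext \<open>0 < \<eta>\<close> by simp
        then have "- (\<zeta> x / \<kappa>) * exp (\<alpha>' * ?t) \<le> v (traj ?F x ?t)"
          using \<open>\<kappa> > 0\<close> by (simp add: field_simps)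
        then have "\<gamma> powr ?t * (- (\<zeta> x / \<kappa>) * exp (\<alpha>' * ?t)) \<le> \<gamma> powr ?t * v (traj ?F x ?t)"
          by (intro mult_left_mono) auto
        moreover have "\<gamma> powr ?t * exp (\<alpha>' * ?t) = exp ((\<alpha>' + ln \<gamma>) * ?t)"
          using discount(1) by (simp add: powr_def exp_add[symmetric] algebra_simps)
        ultimately show "- (\<zeta> x / \<kappa>) * exp ((\<alpha>' + ln \<gamma>) * ?t) \<le> \<gamma> powr ?t * v (traj ?F x ?t)"
          by (simp add: mult.left_commute)
      qed
      show "eventually (\<lambda>n. \<gamma> powr (real n * \<eta>) * v (traj ?F x (real n * \<eta>)) \<le> 0) sequentially"
        using v by (intro always_eventually allI) (simp add: mult_nonneg_nonpos)
      show "(\<lambda>n. - (\<zeta> x / \<kappa>) * exp ((\<alpha>' + ln \<gamma>) * (real n * \<eta>))) \<longlonglongrightarrow> 0"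
        using \<open>\<alpha>' < - ln \<gamma>\<close> \<open>0 < \<eta>\<close>
        by (intro tendsto_mult_right_zero exp_multiple_tendsto_0) auto
    qed simp
    then show ?thesis
      using ext \<open>0 < \<eta>\<close> integral_bellman_has_integral_multiple[OF F k bell \<open>0 < \<eta>\<close> discount(1)]
      by (intro exI[of _ \<eta>]) auto
  qed
  then obtain \<eta> where "0 < \<eta>" and ext: "\<And>x. exit_time ?F x = \<infinity>"
    and int: "\<And>x n. ((\<lambda>t. \<gamma> powr t * ?k (traj ?F x t)) has_integral
      \<gamma> powr (real n * \<eta>) * v (traj ?F x (real n * \<eta>)) - v x) {0..real n * \<eta>}"
    and lim: "\<And>x. (\<lambda>n. \<gamma> powr (real n * \<eta>) * v (traj ?F x (real n * \<eta>))) \<longlonglongrightarrow> 0"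
    by blast
  have cost: "cost_value f c \<gamma> \<pi> x = ennreal (- v x)" for x
  proof -
    \<comment> \<open>These are the costs up to time \<open>real n * \<eta>\<close>; their limit is
      the total cost.\<close>
    have "(\<lambda>n. \<gamma> powr (real n * \<eta>) * v (traj ?F x (real n * \<eta>)) - v x) \<longlonglongrightarrow> 0 - v x"
      by (intro tendsto_diff lim tendsto_const)
    then have "(\<integral>\<^sup>+t\<in>{0..}. ennreal (\<gamma> powr t * ?k (traj ?F x t)) \<partial>lborel) = ennreal (0 - v x)"
      by (intro nn_integral_atLeast_eq_limit[OF _ _ \<open>0 < \<eta>\<close> int]
          continuous_on_discounted_along_traj[OF F ext k discount(1)])
        (simp_all add: k_nonneg)
    then show ?thesis
      by (simp add: cost_value_def ext)
  qed
  \<comment> \<open>The cost value is finite as the image of a real number, and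
    \<open>v x \<le> 0\<close> ensures that \<open>ennreal\<close> does not truncate
    \<open>- v x\<close>.\<close>
  then show ?thesis
    using \<open>\<pi> \<in> policies0 U\<close> v
    by (simp add: admissible_policies_def value_fn_def enn2ereal_ennreal)
qed

end
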